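(* Let $r\geq 2$ and $k\geq 1$ be integers. Suppose that there exists a finite projective plane of order $r$ and a $k$-regular, not necessarily connected graph $\Gamma$ with girth at least $5$ and of order $w$, where $w=r-1$ or $w=r$. Then there exists an $(r,r+k;5)$-babi-graph of order $v$, where $v=2r^2-2$ if $w=r-1$ and $v=2r^2$ if $w=r$, which has exactly $\frac{v}{4}k$ fat edges and no thin edges.
   Context: Graphs are finite and simple. The girth of a graph is the length of its shortest cycle (a graph without cycles is regarded as having infinite girth); the order of a graph is its number of vertices. For integers $1\leq r\leq s$ and $g\geq 3$, an $(r,s;g)$-balanced biregular graph (for short, $(r,s;g)$-babi-graph) is a graph of girth $g$ whose set of vertex degrees equals $\{r,s\}$ and in which the number of vertices of degree $r$ equals the number of vertices of degree $s$. In an $(r,s;g)$-babi-graph with $r<s$, a vertex is thin if its degree is $r$ and fat if its degree is $s$; a thin edge is an edge joining two thin vertices, and a fat edge is an edge joining two fat vertices. A finite projective plane of order $q$ ($q\geq 2$) is an incidence structure with $q^2+q+1$ points and $q^2+q+1$ lines such that any two distinct points are incident with precisely one common line, any two distinct lines are incident with precisely one common point, each line is incident with exactly $q+1$ points, and each point is incident with exactly $q+1$ lines. *)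

theory Defs
  imports Complex_Main "HOL-Library.Extended_Nat" "Graph_Theory.Pair_Digraph"
begin

text \<open>
  A finite simple graph is a \<^locale>\<open>pair_graph\<close>: a finite, loop-free, symmetric digraph whose
  arcs are ordered pairs of vertices. Each undirected edge \<open>{u, v}\<close> is thus represented by the two
  arcs \<open>(u, v)\<close> and \<open>(v, u)\<close>, and the degree of a vertex is its out-degree.
\<close>

abbreviation degree :: "'a pair_pre_digraph \<Rightarrow> 'a \<Rightarrow> nat" where
  "degree G v \<equiv> out_degree (with_proj G) v"

definition edges :: "'a pair_pre_digraph \<Rightarrow> 'a set set" where
  "edges G = (\<lambda>(u, v). {u, v}) ` parcs G"

definition regular :: "nat \<Rightarrow> 'a pair_pre_digraph \<Rightarrow> bool" where
  "regular k G \<longleftrightarrow> (\<forall>v\<in>pverts G. degree G v = k)"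

text \<open>
  The closed walk \<open>u, v, u\<close> is a cycle of a symmetric digraph but not of an undirected graph, hence
  the bound on the length. The infimum of the empty set in \<^typ>\<open>enat\<close> is \<open>\<infinity>\<close>, so acyclic graphs
  have infinite girth.
\<close>

definition girth :: "'a pair_pre_digraph \<Rightarrow> enat" where
  "girth G = (INF p\<in>{p. pre_digraph.cycle (with_proj G) p \<and> 3 \<le> length p}. enat (length p))"

locale babi_graph = pair_graph G for r s g :: nat and G :: "'a pair_pre_digraph" +
  assumes r_pos: "1 \<le> r"
    and r_le_s: "r \<le> s"
    and g_ge_3: "3 \<le> g"
    and girth_eq: "girth G = enat g"
    and degree_set: "degree G ` pverts G = {r, s}"
    and balanced: "card {v \<in> pverts G. degree G v = r} = card {v \<in> pverts G. degree G v = s}"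

text \<open>
  The following two notions are meant for an \<open>(r, s; g)\<close>-babi-graph with \<open>r < s\<close>: thin vertices
  have degree \<open>r\<close> and fat vertices have degree \<open>s\<close>.
\<close>

definition thin_edges :: "nat \<Rightarrow> 'a pair_pre_digraph \<Rightarrow> 'a set set" where
  "thin_edges r G = {e \<in> edges G. \<forall>v\<in>e. degree G v = r}"

definition fat_edges :: "nat \<Rightarrow> 'a pair_pre_digraph \<Rightarrow> 'a set set" where
  "fat_edges s G = {e \<in> edges G. \<forall>v\<in>e. degree G v = s}"

text \<open>
  The cardinalities below are positive, so both \<open>P\<close> and \<open>L\<close> are finite.
\<close>

locale finite_projective_plane =
  fixes q :: nat
    and P :: "'p set"
    and L :: "'l set"
    and incident :: "'p \<Rightarrow> 'l \<Rightarrow> bool"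
  assumes order_ge_2: "2 \<le> q"
    and card_points: "card P = q^2 + q + 1"
    and card_lines: "card L = q^2 + q + 1"
    and unique_line:
      "\<lbrakk>x \<in> P; y \<in> P; x \<noteq> y\<rbrakk> \<Longrightarrow> \<exists>!l. l \<in> L \<and> incident x l \<and> incident y l"
    and unique_point:
      "\<lbrakk>l \<in> L; m \<in> L; l \<noteq> m\<rbrakk> \<Longrightarrow> \<exists>!x. x \<in> P \<and> incident x l \<and> incident x m"
    and points_per_line: "l \<in> L \<Longrightarrow> card {x \<in> P. incident x l} = q + 1"
    and lines_per_point: "x \<in> P \<Longrightarrow> card {l \<in> L. incident x l} = q + 1"

end

theory Submission
  imports Defs
begin

text \<open>
  Choose a point \<open>p\<close> and a line \<open>l\<close> of the plane and delete them, together with all points on \<open>l\<close>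
  and all lines through \<open>p\<close>. Every remaining point \<open>x\<close> loses exactly one of its \<open>r + 1\<close> lines,
  namely the line \<open>px\<close>, and dually for lines; so the incidence graph of what remains is
  \<open>r\<close>-regular. The remaining points fall into groups, two points being in the same group if they
  are collinear with \<open>p\<close>. A group is what is left of a line through \<open>p\<close>: that line also loses its
  common point with \<open>l\<close>, which is \<open>p\<close> itself if \<open>p\<close> lies on \<open>l\<close> and a further point otherwise.
  Groups thus have \<open>r\<close> points if \<open>p\<close> lies on \<open>l\<close> and \<open>r - 1\<close> points if not, and the points
  number \<open>r\<^sup>2\<close> and \<open>r\<^sup>2 - 1\<close> respectively: the flag serves \<open>w = r\<close>, the antiflag \<open>w = r - 1\<close>.

  Two points of the same group have no remaining common line, since their only common line passed
  through \<open>p\<close>; two points of different groups keep their common line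
  (\<open>plane_minus_point_and_line\<close>). Now place a copy of \<open>\<Gamma>\<close> on each group. Points become fat, of
  degree \<open>r + k\<close>; lines stay thin, of degree \<open>r\<close>. No edge joins two lines, so there are no thin
  edges, and the fat edges are those of the copies of \<open>\<Gamma>\<close>, half of \<open>k\<close> times the number of points.

  A triangle or quadrilateral that avoids all lines lies in one copy of \<open>\<Gamma>\<close>. If it visits a line
  \<open>m\<close>, the two neighbours of \<open>m\<close> on it are distinct points of \<open>m\<close>, hence in different groups, so
  they cannot be adjacent or have a common neighbour among the points; nor can they have a second
  common line (\<open>no_triangle\<close>, \<open>no_quadrilateral\<close>). On the other hand an edge of \<open>\<Gamma>\<close> in some group
  closes up to a pentagon through the two lines that join its ends to a point of another group
  (\<open>girth_graph\<close>).
\<close>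

section \<open>Degrees, edges and short cycles of simple graphs\<close>

lemma degree_eq_card_neighbours: "degree G v = card {u. (v, u) \<in> parcs G}"
proof -
  have "out_arcs (with_proj G) v = Pair v ` {u. (v, u) \<in> parcs G}"
    by (auto simp: out_arcs_def)
  then show ?thesis
    by (simp add: out_degree_def card_image inj_on_def)
qed

text \<open>
  Each undirected edge has exactly two orientations, which are distinct as there are no loops.
\<close>

lemma card_undirected_edges:
  assumes "finite A" and sym: "\<And>u v. (u, v) \<in> A \<Longrightarrow> (v, u) \<in> A" and irrefl: "\<And>u. (u, u) \<notin> A"
  shows "2 * card ((\<lambda>(u, v). {u, v}) ` A) = card A"
proof -
  let ?e = "\<lambda>(u, v). {u, v}"
  have fibre: "card {a \<in> A. ?e a = e} = 2" if "e \<in> ?e ` A" for e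
  proof -
    from that obtain u v where uv: "(u, v) \<in> A" "e = {u, v}" by auto
    with sym irrefl have "{a \<in> A. ?e a = e} = {(u, v), (v, u)}"
      by (auto simp: doubleton_eq_iff)
    moreover have "u \<noteq> v" using uv irrefl by auto
    ultimately show ?thesis by simp
  qed
  have "card A = (\<Sum>e\<in>?e ` A. card {a \<in> A. ?e a = e})"
    using sum.image_gen[OF \<open>finite A\<close>, where g = ?e and h = "\<lambda>_. 1 :: nat"] by simp
  also have "\<dots> = 2 * card (?e ` A)"
    by (simp add: fibre)
  finally show ?thesis by simp
qed

lemma girth_le_cycle:
  "pre_digraph.cycle (with_proj G) p \<Longrightarrow> 3 \<le> length p \<Longrightarrow> girth G \<le> enat (length p)"
  unfolding girth_def by (rule INF_lower) auto

context pair_graph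
begin

text \<open>
  The girth speaks of cycles as arc lists. The following three lemmas translate girth at least 5
  and girth 5 into statements on adjacency that can be checked by cases on the kinds of vertices.
  In a quadrilateral only opposite vertices have to be required distinct.
\<close>

lemma girth_ge_5_no_triangle:
  assumes "5 \<le> girth G" and "(a, b) \<in> parcs G" "(b, c) \<in> parcs G" "(c, a) \<in> parcs G"
  shows False
proof -
  have "cycle [(a, b), (b, c), (c, a)]"
    using assms no_loops' in_arcsD1 unfolding cycle_def awalk_def by (intro exI[of _ a]) auto
  from girth_le_cycle[OF this] assms(1) have "(5::enat) \<le> enat 3"
    by (metis (no_types, lifting) dual_order.trans le_refl length_Cons list.size(3) numeral_3_eq_3)
  then show False by (simp add: numeral_eq_enat)
qed

lemma girth_ge_5_no_quadrilateral:
  assumes "5 \<le> girth G"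
    and "(a, b) \<in> parcs G" "(b, c) \<in> parcs G" "(c, d) \<in> parcs G" "(d, a) \<in> parcs G"
    and "a \<noteq> c" "b \<noteq> d"
  shows False
proof -
  have "cycle [(a, b), (b, c), (c, d), (d, a)]"
    using assms no_loops' in_arcsD1 unfolding cycle_def awalk_def by (intro exI[of _ a]) auto
  from girth_le_cycle[OF this] assms(1) have "(5::enat) \<le> enat 4"
    using order_trans by fastforce
  then show False by (simp add: numeral_eq_enat)
qed

lemma girth_eq_5I:
  assumes triangle: "\<And>a b c. (a, b) \<in> parcs G \<Longrightarrow> (b, c) \<in> parcs G \<Longrightarrow> (c, a) \<in> parcs G \<Longrightarrow> False"
    and quadrilateral: "\<And>a b c d. (a, b) \<in> parcs G \<Longrightarrow> (b, c) \<in> parcs G \<Longrightarrow> (c, d) \<in> parcs G \<Longrightarrow>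
      (d, a) \<in> parcs G \<Longrightarrow> a \<noteq> c \<Longrightarrow> b \<noteq> d \<Longrightarrow> False"
    and pentagon: "(a, b) \<in> parcs G" "(b, c) \<in> parcs G" "(c, d) \<in> parcs G" "(d, e) \<in> parcs G"
      "(e, a) \<in> parcs G" "distinct [a, b, c, d, e]"
  shows "girth G = 5"
proof (rule antisym)
  have "cycle [(a, b), (b, c), (c, d), (d, e), (e, a)]"
    using pentagon in_arcsD1 unfolding cycle_def awalk_def by (intro exI[of _ a]) auto
  from girth_le_cycle[OF this] show "girth G \<le> 5"
    by (simp add: numeral_eq_enat eval_nat_numeral)
  show "5 \<le> girth G"
    unfolding girth_def
  proof (rule INF_greatest)
    fix p assume "p \<in> {p. cycle p \<and> 3 \<le> length p}"
    then have p: "cycle p" "3 \<le> length p" by auto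
    have "length p \<noteq> 3"
    proof
      assume "length p = 3"
      then obtain x y z where "p = [x, y, z]"
        by (auto simp: numeral_3_eq_3 length_Suc_conv)
      with p(1) triangle show False
        unfolding cycle_def awalk_def by (cases x; cases y; cases z) auto
    qed
    moreover have "length p \<noteq> 4"
    proof
      assume "length p = 4"
      then obtain x y z t where "p = [x, y, z, t]"
        by (auto simp: numeral_eq_Suc length_Suc_conv)
      with p(1) quadrilateral show False
        unfolding cycle_def awalk_def by (cases x; cases y; cases z; cases t) auto
    qed
    ultimately show "5 \<le> enat (length p)"
      using p(2) by (simp add: numeral_eq_enat)
  qed
qed

end

section \<open>Adding a graph inside the groups of a design\<close>

text \<open>
  The symmetric group divisible designs with parameters \<open>\<lambda>\<^sub>1 = 0\<close> and \<open>\<lambda>\<^sub>2 = 1\<close>: as many blocks as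
  points, and two points lie in no common block if they belong to the same group and in exactly
  one otherwise. These are the features common to the flag and the antiflag case. Points and
  blocks have the same type since both become vertices of one graph, and \<open>grp\<close> names the group of a
  point by an arbitrary label. The bound \<open>w < n\<close> excludes a design with a single group, where no
  pentagon need arise.
\<close>

locale group_divisible_design =
  fixes n r w :: nat
    and Q M :: "'v set"
    and inc :: "'v \<Rightarrow> 'v \<Rightarrow> bool"
    and grp :: "'v \<Rightarrow> 'v"
  assumes finite_Q: "finite Q" and finite_M: "finite M" and disjoint: "Q \<inter> M = {}"
    and card_Q: "card Q = n" and card_M: "card M = n"
    and blocks_of_point: "x \<in> Q \<Longrightarrow> card {m \<in> M. inc x m} = r"
    and points_of_block: "m \<in> M \<Longrightarrow> card {x \<in> Q. inc x m} = r"
    and joined: "x \<in> Q \<Longrightarrow> y \<in> Q \<Longrightarrow> grp x \<noteq> grp y \<Longrightarrow> \<exists>m\<in>M. inc x m \<and> inc y m"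
    and unjoined: "x \<in> Q \<Longrightarrow> y \<in> Q \<Longrightarrow> m \<in> M \<Longrightarrow> inc x m \<Longrightarrow> inc y m \<Longrightarrow> grp x = grp y \<Longrightarrow> x = y"
    and one_block: "x \<in> Q \<Longrightarrow> y \<in> Q \<Longrightarrow> x \<noteq> y \<Longrightarrow> m \<in> M \<Longrightarrow> m' \<in> M \<Longrightarrow>
      inc x m \<Longrightarrow> inc y m \<Longrightarrow> inc x m' \<Longrightarrow> inc y m' \<Longrightarrow> m = m'"
    and group_size: "x \<in> Q \<Longrightarrow> card {y \<in> Q. grp y = grp x} = w"
    and proper_groups: "w < n"
begin

lemma ex_other_group:
  assumes "x \<in> Q"
  shows "\<exists>y\<in>Q. grp y \<noteq> grp x"
proof (rule ccontr)
  assume "\<not> ?thesis"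
  then have "{y \<in> Q. grp y = grp x} = Q" by auto
  with group_size[OF assms] card_Q proper_groups show False by simp
qed

end

text \<open>
  The labelling \<open>lab\<close> identifies every group with the vertex set of \<open>\<Gamma>\<close>. A single function on all
  points does this for all groups at once.
\<close>

locale amalgam = group_divisible_design n r w Q M inc grp + base: pair_graph \<Gamma>
  for n r w and Q M :: "'v set" and inc grp and \<Gamma> :: "'a pair_pre_digraph" +
  fixes k :: nat and lab :: "'v \<Rightarrow> 'a"
  assumes k_pos: "1 \<le> k" and r_pos: "1 \<le> r"
    and base_regular: "regular k \<Gamma>" and base_girth: "5 \<le> girth \<Gamma>"
    and lab: "x \<in> Q \<Longrightarrow> bij_betw lab {y \<in> Q. grp y = grp x} (pverts \<Gamma>)"
begin

definition group_arcs :: "'v rel" where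
  "group_arcs = {(x, y). x \<in> Q \<and> y \<in> Q \<and> grp x = grp y \<and> (lab x, lab y) \<in> parcs \<Gamma>}"

definition graph :: "'v pair_pre_digraph" where
  "graph = \<lparr>pverts = Q \<union> M,
    parcs = group_arcs \<union> {(x, m). x \<in> Q \<and> m \<in> M \<and> inc x m} \<union> {(m, x). x \<in> Q \<and> m \<in> M \<and> inc x m}\<rparr>"

lemma pverts_graph [simp]: "pverts graph = Q \<union> M"
  by (simp add: graph_def)

lemma arc_point_point: "x \<in> Q \<Longrightarrow> y \<in> Q \<Longrightarrow>
    (x, y) \<in> parcs graph \<longleftrightarrow> grp x = grp y \<and> (lab x, lab y) \<in> parcs \<Gamma>"
  and arc_point_block: "x \<in> Q \<Longrightarrow> m \<in> M \<Longrightarrow> (x, m) \<in> parcs graph \<longleftrightarrow> inc x m"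
  and arc_block_point: "x \<in> Q \<Longrightarrow> m \<in> M \<Longrightarrow> (m, x) \<in> parcs graph \<longleftrightarrow> inc x m"
  and arc_block_block: "m \<in> M \<Longrightarrow> m' \<in> M \<Longrightarrow> (m, m') \<notin> parcs graph"
  using disjoint by (auto simp: graph_def group_arcs_def)

lemmas arc_iff = arc_point_point arc_point_block arc_block_point arc_block_block

lemma arc_in_vertices: "(u, v) \<in> parcs graph \<Longrightarrow> u \<in> Q \<union> M \<and> v \<in> Q \<union> M"
  by (auto simp: graph_def group_arcs_def)

lemma arc_sym: "(u, v) \<in> parcs graph \<Longrightarrow> (v, u) \<in> parcs graph"
  by (auto simp: graph_def group_arcs_def dest: base.arcs_symmetric)

lemma pair_graph_graph: "pair_graph graph"
proof
  show "finite (pverts graph)"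
    by (simp add: finite_Q finite_M)
  then show "finite (parcs graph)"
    by (intro finite_subset[OF _ finite_cartesian_product[of "pverts graph" "pverts graph"]])
      (auto dest: arc_in_vertices)
  show "symmetric (with_proj graph)"
    by (auto simp: symmetric_def sym_def dest: arc_sym)
  show "fst e \<in> pverts graph" "snd e \<in> pverts graph" if "e \<in> parcs graph" for e
    using arc_in_vertices[of "fst e" "snd e"] that by simp_all
  show "fst e \<noteq> snd e" if "e \<in> parcs graph" for e
    using that disjoint base.no_loops' by (fastforce simp: graph_def group_arcs_def)
qed

sublocale pair_graph graph
  by (rule pair_graph_graph)

lemma group_neighbours:
  assumes "x \<in> Q"
  shows "card {y. (x, y) \<in> group_arcs} = k"
proof -
  have labx: "lab x \<in> pverts \<Gamma>"
    using bij_betw_apply[OF lab[OF assms]] assms by simp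
  have "bij_betw lab {y \<in> Q. grp y = grp x \<and> (lab x, lab y) \<in> parcs \<Gamma>} {b. (lab x, b) \<in> parcs \<Gamma>}"
    unfolding bij_betw_def
  proof
    show "inj_on lab {y \<in> Q. grp y = grp x \<and> (lab x, lab y) \<in> parcs \<Gamma>}"
      using bij_betw_imp_inj_on[OF lab[OF assms]] by (rule inj_on_subset) auto
    show "lab ` {y \<in> Q. grp y = grp x \<and> (lab x, lab y) \<in> parcs \<Gamma>} = {b. (lab x, b) \<in> parcs \<Gamma>}"
    proof
      show "{b. (lab x, b) \<in> parcs \<Gamma>} \<subseteq> lab ` {y \<in> Q. grp y = grp x \<and> (lab x, lab y) \<in> parcs \<Gamma>}"
      proof
        fix b assume b: "b \<in> {b. (lab x, b) \<in> parcs \<Gamma>}"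
        then have "b \<in> lab ` {y \<in> Q. grp y = grp x}"
          using bij_betw_imp_surj_on[OF lab[OF assms]] base.in_arcsD2 by auto
        with b show "b \<in> lab ` {y \<in> Q. grp y = grp x \<and> (lab x, lab y) \<in> parcs \<Gamma>}" by auto
      qed
    qed auto
  qed
  moreover have "{y. (x, y) \<in> group_arcs} = {y \<in> Q. grp y = grp x \<and> (lab x, lab y) \<in> parcs \<Gamma>}"
    using assms by (auto simp: group_arcs_def)
  ultimately have "card {y. (x, y) \<in> group_arcs} = degree \<Gamma> (lab x)"
    by (simp add: degree_eq_card_neighbours bij_betw_same_card)
  with base_regular labx show ?thesis by (simp add: regular_def)
qed

lemma degree_point:
  assumes "x \<in> Q"
  shows "degree graph x = r + k"
proof -
  have fin: "finite {y. (x, y) \<in> group_arcs}"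
    by (rule finite_subset[OF _ finite_Q]) (auto simp: group_arcs_def)
  have "{u. (x, u) \<in> parcs graph} = {m \<in> M. inc x m} \<union> {y. (x, y) \<in> group_arcs}"
    using assms disjoint by (auto simp: graph_def)
  moreover have "{m \<in> M. inc x m} \<inter> {y. (x, y) \<in> group_arcs} = {}"
    using disjoint by (auto simp: group_arcs_def)
  ultimately show ?thesis
    using assms fin finite_M
    by (simp add: degree_eq_card_neighbours card_Un_disjoint blocks_of_point group_neighbours)
qed

lemma degree_block:
  assumes "m \<in> M"
  shows "degree graph m = r"
proof -
  have "{u. (m, u) \<in> parcs graph} = {x \<in> Q. inc x m}"
    using assms disjoint by (auto simp: graph_def group_arcs_def)
  with points_of_block[OF assms] show ?thesis
    by (simp add: degree_eq_card_neighbours)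
qed

lemma vertices_of_degree:
  "{v \<in> pverts graph. degree graph v = r} = M"
  "{v \<in> pverts graph. degree graph v = r + k} = Q"
proof -
  have "degree graph v = r \<longleftrightarrow> v \<in> M" "degree graph v = r + k \<longleftrightarrow> v \<in> Q" if "v \<in> Q \<union> M" for v
    using that k_pos disjoint degree_point[of v] degree_block[of v] by auto
  then show "{v \<in> pverts graph. degree graph v = r} = M"
    "{v \<in> pverts graph. degree graph v = r + k} = Q"
    by auto
qed

text \<open>
  The neighbours \<open>x\<close> and \<open>y\<close> of a block are points of it; if they were adjacent they would also
  share a group, which two distinct points of a block never do.
\<close>

lemma no_triangle_through_block:
  assumes "m \<in> M" "(m, x) \<in> parcs graph" "(x, y) \<in> parcs graph" "(y, m) \<in> parcs graph"
  shows False
proof -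
  have "x \<in> Q" "y \<in> Q"
    using assms arc_in_vertices arc_block_block by blast+
  with assms unjoined have "x = y" by (auto simp: arc_iff)
  with assms no_loops' show False by auto
qed

lemma no_triangle:
  assumes "(a, b) \<in> parcs graph" "(b, c) \<in> parcs graph" "(c, a) \<in> parcs graph"
  shows False
proof (cases "a \<in> M \<or> b \<in> M \<or> c \<in> M")
  case True
  with assms no_triangle_through_block show ?thesis by blast
next
  case False
  with assms have "a \<in> Q" "b \<in> Q" "c \<in> Q"
    using arc_in_vertices by blast+
  with assms base.girth_ge_5_no_triangle[OF base_girth] show ?thesis
    by (auto simp: arc_iff)
qed

text \<open>
  If the vertex \<open>u\<close> opposite to \<open>m\<close> is a point, it puts \<open>x\<close> and \<open>y\<close> in the same group although both
  lie in the block \<open>m\<close>. If it is a block, then \<open>x\<close> and \<open>y\<close> lie in the two blocks \<open>m\<close> and \<open>u\<close>.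
\<close>

lemma no_quadrilateral_through_block:
  assumes "m \<in> M" "(m, x) \<in> parcs graph" "(x, u) \<in> parcs graph" "(u, y) \<in> parcs graph"
    "(y, m) \<in> parcs graph" "m \<noteq> u" "x \<noteq> y"
  shows False
proof -
  have Q: "x \<in> Q" "y \<in> Q"
    using assms arc_in_vertices arc_block_block by blast+
  consider "u \<in> Q" | "u \<in> M"
    using assms arc_in_vertices by blast
  then show False
  proof cases
    case 1
    with assms Q have "grp x = grp y" by (simp add: arc_iff)
    with assms Q unjoined show False by (auto simp: arc_iff)
  next
    case 2
    with assms Q one_block[of x y m u] show False by (auto simp: arc_iff)
  qed
qed

lemma no_quadrilateral:
  assumes "(a, b) \<in> parcs graph" "(b, c) \<in> parcs graph" "(c, d) \<in> parcs graph" "(d, a) \<in> parcs graph"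
    and "a \<noteq> c" "b \<noteq> d"
  shows False
proof (cases "a \<in> M \<or> b \<in> M \<or> c \<in> M \<or> d \<in> M")
  case True
  \<comment> \<open>rotate the quadrilateral until it starts at a block\<close>
  then show ?thesis
    using no_quadrilateral_through_block[of a b c d] no_quadrilateral_through_block[of b c d a]
      no_quadrilateral_through_block[of c d a b] no_quadrilateral_through_block[of d a b c] assms
    by argo
next
  case False
  with assms have Q: "a \<in> Q" "b \<in> Q" "c \<in> Q" "d \<in> Q"
    using arc_in_vertices by blast+
  with assms have "grp a = grp b" "grp b = grp c" "grp c = grp d" by (auto simp: arc_iff)
  with assms Q bij_betw_imp_inj_on[OF lab[of a]] have "lab a \<noteq> lab c" "lab b \<noteq> lab d"
    by (auto simp: inj_on_def)
  with assms Q base.girth_ge_5_no_quadrilateral[OF base_girth, of "lab a" "lab b" "lab c" "lab d"]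
  show ?thesis by (auto simp: arc_iff)
qed

text \<open>
  The pentagon consists of an edge \<open>xy\<close> inside a group, a point \<open>z\<close> of another group, and the
  blocks through \<open>x, z\<close> and through \<open>y, z\<close>. These blocks differ because no block contains both \<open>x\<close>
  and \<open>y\<close>.
\<close>

lemma girth_graph: "girth graph = 5"
proof -
  from proper_groups card_Q obtain x where x: "x \<in> Q" by fastforce
  with group_neighbours k_pos obtain y where xy: "(x, y) \<in> group_arcs"
    by (metis (no_types, lifting) card.empty empty_Collect_eq not_one_le_zero)
  then have y: "y \<in> Q" "grp y = grp x" "(x, y) \<in> parcs graph"
    by (auto simp: group_arcs_def graph_def)
  then have "x \<noteq> y" using no_loops' by auto
  from ex_other_group[OF x] obtain z where z: "z \<in> Q" "grp z \<noteq> grp x" by auto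
  obtain l where l: "l \<in> M" "inc x l" "inc z l" using joined[OF x z(1)] z(2) by auto
  obtain m where m: "m \<in> M" "inc y m" "inc z m" using joined[OF y(1) z(1)] z(2) y(2) by auto
  have "l \<noteq> m" using unjoined[OF x y(1), of l] l m y(2) \<open>x \<noteq> y\<close> by auto
  then have "distinct [x, y, m, z, l]"
    using x y z l m \<open>x \<noteq> y\<close> disjoint by auto
  moreover have "(x, y) \<in> parcs graph" "(y, m) \<in> parcs graph" "(m, z) \<in> parcs graph"
    "(z, l) \<in> parcs graph" "(l, x) \<in> parcs graph"
    using x y z l m by (simp_all add: arc_iff)
  ultimately show ?thesis
    by (intro girth_eq_5I[of x y m z l]) (blast intro: no_triangle no_quadrilateral)+
qed

lemma babi_graph_graph: "babi_graph r (r + k) 5 graph"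
proof
  show "girth graph = enat 5"
    by (simp add: girth_graph numeral_eq_enat)
  have "Q \<noteq> {}" "M \<noteq> {}"
    using proper_groups card_Q card_M by auto
  moreover have "degree graph ` Q = (\<lambda>_. r + k) ` Q" "degree graph ` M = (\<lambda>_. r) ` M"
    by (simp_all add: degree_point degree_block)
  ultimately show "degree graph ` pverts graph = {r, r + k}"
    by (auto simp: image_Un)
  show "card {v \<in> pverts graph. degree graph v = r} = card {v \<in> pverts graph. degree graph v = r + k}"
    by (simp only: vertices_of_degree card_Q card_M)
qed (use r_pos in auto)

lemma card_pverts_graph: "card (pverts graph) = 2 * n"
  by (simp add: card_Un_disjoint finite_Q finite_M disjoint card_Q card_M)

lemma edge_iff: "e \<in> edges graph \<longleftrightarrow> (\<exists>u v. e = {u, v} \<and> (u, v) \<in> parcs graph)"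
  by (auto simp: edges_def)

lemma thin_edges_graph: "thin_edges r graph = {}"
proof -
  have "v \<in> M" if "(u, v) \<in> parcs graph \<or> (v, u) \<in> parcs graph" "degree graph v = r" for u v
    using that arc_in_vertices degree_point[of v] k_pos by force
  with arc_block_block show ?thesis
    unfolding thin_edges_def edge_iff by blast
qed

lemma fat_edges_graph: "fat_edges (r + k) graph = (\<lambda>(u, v). {u, v}) ` group_arcs"
proof -
  have "u \<in> Q" if "(u, v) \<in> parcs graph \<or> (v, u) \<in> parcs graph" "degree graph u = r + k" for u v
    using that arc_in_vertices degree_block[of u] k_pos by force
  then have "(u, v) \<in> group_arcs \<longleftrightarrow>
      (u, v) \<in> parcs graph \<and> degree graph u = r + k \<and> degree graph v = r + k" for u v
    using disjoint degree_point unfolding graph_def group_arcs_def by auto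
  then show ?thesis
    unfolding fat_edges_def edges_def by auto
qed

lemma card_fat_edges_graph: "2 * card (fat_edges (r + k) graph) = n * k"
proof -
  have fin: "finite group_arcs"
    by (rule finite_subset[OF _ finite_cartesian_product[OF finite_Q finite_Q]])
      (auto simp: group_arcs_def)
  have "group_arcs = (SIGMA x:Q. {y. (x, y) \<in> group_arcs})"
    by (auto simp: group_arcs_def)
  moreover have "finite {y. (x, y) \<in> group_arcs}" for x
    by (rule finite_subset[OF _ finite_Q]) (auto simp: group_arcs_def)
  ultimately have "card group_arcs = (\<Sum>x\<in>Q. card {y. (x, y) \<in> group_arcs})"
    using card_SigmaI[OF finite_Q, of "\<lambda>x. {y. (x, y) \<in> group_arcs}"] by simp
  also have "\<dots> = n * k"
    by (simp add: group_neighbours card_Q)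
  finally have "card group_arcs = n * k" .
  moreover have "2 * card (fat_edges (r + k) graph) = card group_arcs"
    unfolding fat_edges_graph
  proof (rule card_undirected_edges[OF fin])
    show "(v, u) \<in> group_arcs" if "(u, v) \<in> group_arcs" for u v
      using that base.arcs_symmetric by (auto simp: group_arcs_def)
    show "(u, u) \<notin> group_arcs" for u
      using base.no_loops' by (auto simp: group_arcs_def)
  qed
  ultimately show ?thesis by simp
qed

end

text \<open>
  All groups have the size of \<open>V\<close>, so a bijection can be chosen group by group; the groups are
  disjoint, so these bijections combine to one function.
\<close>

lemma (in group_divisible_design) ex_group_labelling:
  assumes "finite V" "card V = w"
  shows "\<exists>lab. \<forall>x\<in>Q. bij_betw lab {y \<in> Q. grp y = grp x} V"
proof -
  have "\<exists>h. bij_betw h {y \<in> Q. grp y = g} V" if "g \<in> grp ` Q" for g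
    using that group_size assms finite_Q by (auto intro!: finite_same_card_bij)
  then obtain h where h: "\<And>g. g \<in> grp ` Q \<Longrightarrow> bij_betw (h g) {y \<in> Q. grp y = g} V"
    by metis
  have "bij_betw (\<lambda>y. h (grp y) y) {y \<in> Q. grp y = grp x} V" if "x \<in> Q" for x
    using h[of "grp x"] that bij_betw_cong[of "{y \<in> Q. grp y = grp x}" "\<lambda>y. h (grp y) y" "h (grp x)" V]
    by simp
  then show ?thesis by (intro exI[of _ "\<lambda>y. h (grp y) y"]) auto
qed

section \<open>Deleting a point and a line from a projective plane\<close>

context finite_projective_plane
begin

text \<open>
  Duality turns every count of points below into a count of lines.
\<close>

lemma dual: "finite_projective_plane q L P (\<lambda>l x. incident x l)"
  using order_ge_2 card_points card_lines unique_line unique_point points_per_line lines_per_point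
  by unfold_locales auto

lemma finite_points: "finite P"
  using card_points by (simp add: card_ge_0_finite)

lemma card_points_off:
  assumes "p \<in> P" "l \<in> L"
  shows "card {x \<in> P. x \<noteq> p \<and> \<not> incident x l} = (if incident p l then q^2 else q^2 - 1)"
proof -
  have "{x \<in> P. x \<noteq> p \<and> \<not> incident x l} = P - insert p {x \<in> P. incident x l}" by auto
  moreover have "card (insert p {x \<in> P. incident x l}) = (if incident p l then q + 1 else q + 2)"
    using assms finite_points points_per_line[OF assms(2)]
    by (auto simp: card_insert_if)
  moreover have "card (P - insert p {x \<in> P. incident x l}) = card P - card (insert p {x \<in> P. incident x l})"
    using assms finite_points by (intro card_Diff_subset) auto
  ultimately show ?thesis
    by (simp add: card_points)
qed

text \<open>
  Of the \<open>q + 1\<close> lines through \<open>x\<close>, only the one joining \<open>x\<close> to \<open>p\<close> is lost; the line \<open>l\<close> does not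
  pass through \<open>x\<close> in the first place.
\<close>

lemma card_lines_avoiding:
  assumes "p \<in> P" "l \<in> L" "x \<in> P" "x \<noteq> p" "\<not> incident x l"
  shows "card {m \<in> {m \<in> L. m \<noteq> l \<and> \<not> incident p m}. incident x m} = q"
proof -
  obtain j where j: "j \<in> L" "incident x j" "incident p j"
    "\<And>m. m \<in> L \<Longrightarrow> incident x m \<Longrightarrow> incident p m \<Longrightarrow> m = j"
    using unique_line[OF assms(3,1,4)] by blast
  have "{m \<in> {m \<in> L. m \<noteq> l \<and> \<not> incident p m}. incident x m} = {m \<in> L. incident x m} - {j}"
    using j(2,3) assms(5) by (auto intro: j(4))
  then show ?thesis
    using j(1,2) lines_per_point[OF assms(3)] by (simp add: card_Diff_singleton)
qed

lemma ex_flag: "\<exists>p\<in>P. \<exists>l\<in>L. incident p l"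
proof -
  have "L \<noteq> {}" using card_lines by auto
  then obtain l where l: "l \<in> L" by blast
  from points_per_line[OF l] have "{x \<in> P. incident x l} \<noteq> {}"
    by (metis Suc_eq_plus1 card.empty nat.distinct(1))
  with l show ?thesis by blast
qed

lemma ex_antiflag: "\<exists>p\<in>P. \<exists>l\<in>L. \<not> incident p l"
proof (rule ccontr)
  assume *: "\<not> ?thesis"
  have "L \<noteq> {}" using card_lines by auto
  then obtain l where l: "l \<in> L" by blast
  with * have "{x \<in> P. incident x l} = P" by auto
  with points_per_line[OF l] card_points order_ge_2 show False by simp
qed

definition line_through :: "'p \<Rightarrow> 'p \<Rightarrow> 'l" where
  "line_through x y = (THE l. l \<in> L \<and> incident x l \<and> incident y l)"

lemma line_through:
  assumes "x \<in> P" "y \<in> P" "x \<noteq> y"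
  shows "line_through x y \<in> L" "incident x (line_through x y)" "incident y (line_through x y)"
  using theI'[OF unique_line[OF assms]] by (simp_all add: line_through_def)

lemma line_through_eqI:
  assumes "x \<in> P" "y \<in> P" "x \<noteq> y" "l \<in> L" "incident x l" "incident y l"
  shows "line_through x y = l"
  using unique_line[OF assms(1-3)] line_through[OF assms(1-3)] assms by blast

text \<open>
  The points \<open>y\<close> counted are those of the line \<open>px\<close> other than \<open>p\<close> and its intersection \<open>z\<close> with \<open>l\<close>.
  The two deleted points coincide precisely if \<open>p\<close> lies on \<open>l\<close>.
\<close>

lemma card_points_on_line_through:
  assumes "p \<in> P" "l \<in> L" "x \<in> P" "x \<noteq> p" "\<not> incident x l"
  shows "card {y \<in> {y \<in> P. y \<noteq> p \<and> \<not> incident y l}. line_through p y = line_through p x} =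
    (if incident p l then q else q - 1)"
proof -
  let ?j = "line_through p x"
  have j: "?j \<in> L" "incident p ?j" "incident x ?j"
    using line_through[of p x] assms by auto
  then have "?j \<noteq> l" using assms by auto
  then obtain z where z: "z \<in> P" "incident z ?j" "incident z l"
    "\<And>y. y \<in> P \<Longrightarrow> incident y ?j \<Longrightarrow> incident y l \<Longrightarrow> y = z"
    by (metis unique_point[OF j(1) assms(2)])
  have "line_through p y = ?j \<longleftrightarrow> incident y ?j" if "y \<in> P" "y \<noteq> p" for y
    using that j assms(1) line_through(3)[of p y] line_through_eqI[of p y ?j] by metis
  then have "{y \<in> {y \<in> P. y \<noteq> p \<and> \<not> incident y l}. line_through p y = ?j} =
      {y \<in> P. incident y ?j} - {p, z}"
    using z(2,3) by (auto intro: z(4))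
  moreover have "card ({y \<in> P. incident y ?j} - {p, z}) = q + 1 - card {p, z}"
    using points_per_line[OF j(1)] z(1,2) j(2) assms(1) by (subst card_Diff_subset) auto
  moreover have "p = z \<longleftrightarrow> incident p l"
    using z(3) z(4)[of p] j(2) assms(1) by auto
  ultimately show ?thesis
    by (auto simp: card_insert_if)
qed

end

lemma bij_betw_ex1:
  assumes h: "bij_betw h A B" and ex1: "\<exists>!y. y \<in> B \<and> R y"
  shows "\<exists>!x. x \<in> A \<and> R (h x)"
proof -
  from ex1 obtain y where y: "y \<in> B" "R y" by auto
  from h y(1) obtain x where x: "x \<in> A" "h x = y"
    by (auto simp: bij_betw_def)
  show ?thesis
  proof (rule ex1I[of _ x])
    show "x \<in> A \<and> R (h x)" using x y by simp
    show "z = x" if z: "z \<in> A \<and> R (h z)" for z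
    proof -
      have "h z = y"
        using ex1 y z bij_betw_apply[OF h, of z] by auto
      with x z show ?thesis
        using inj_onD[OF bij_betw_imp_inj_on[OF h], of z x] by simp
    qed
  qed
qed

lemma bij_betw_card_Collect:
  assumes "bij_betw h A B"
  shows "card {x \<in> A. R (h x)} = card {y \<in> B. R y}"
proof -
  have "bij_betw h {x \<in> A. R (h x)} {y \<in> B. R y}"
    using assms unfolding bij_betw_def by (auto intro: inj_on_subset)
  then show ?thesis by (rule bij_betw_same_card)
qed

text \<open>
  The vertices of the graph to be constructed are natural numbers, and points and lines have to
  be distinguishable among them: so the points are numbered first and the lines after them.
\<close>

lemma (in finite_projective_plane) relabel:
  "\<exists>(P' :: nat set) (L' :: nat set) inc'. finite_projective_plane q P' L' inc' \<and> P' \<inter> L' = {}"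
proof -
  define n where "n = q^2 + q + 1"
  have finite_lines: "finite L"
    using finite_projective_plane.finite_points[OF dual] .
  obtain f where f: "bij_betw f {..<n} P"
    using finite_same_card_bij[OF _ finite_points, of "{..<n}"] card_points by (auto simp: n_def)
  obtain g where g: "bij_betw g {n..<2 * n} L"
    using finite_same_card_bij[OF _ finite_lines, of "{n..<2 * n}"] card_lines by (auto simp: n_def)
  note fP = bij_betw_apply[OF f] and gL = bij_betw_apply[OF g]
  have f_eq: "f x = f y \<longleftrightarrow> x = y" if "x \<in> {..<n}" "y \<in> {..<n}" for x y
    using bij_betw_imp_inj_on[OF f] that by (rule inj_on_eq_iff)
  have g_eq: "g x = g y \<longleftrightarrow> x = y" if "x \<in> {n..<2 * n}" "y \<in> {n..<2 * n}" for x y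
    using bij_betw_imp_inj_on[OF g] that by (rule inj_on_eq_iff)
  have "finite_projective_plane q {..<n} {n..<2 * n} (\<lambda>x l. incident (f x) (g l))"
  proof
    show "\<exists>!l. l \<in> {n..<2 * n} \<and> incident (f x) (g l) \<and> incident (f y) (g l)"
      if "x \<in> {..<n}" "y \<in> {..<n}" "x \<noteq> y" for x y
      using bij_betw_ex1[OF g unique_line[of "f x" "f y"]] fP f_eq that by auto
    show "\<exists>!x. x \<in> {..<n} \<and> incident (f x) (g l) \<and> incident (f x) (g m)"
      if "l \<in> {n..<2 * n}" "m \<in> {n..<2 * n}" "l \<noteq> m" for l m
      using bij_betw_ex1[OF f unique_point[of "g l" "g m"]] gL g_eq that by auto
    show "card {x \<in> {..<n}. incident (f x) (g l)} = q + 1" if "l \<in> {n..<2 * n}" for l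
      using bij_betw_card_Collect[OF f, of "\<lambda>x. incident x (g l)"] points_per_line gL that by simp
    show "card {l \<in> {n..<2 * n}. incident (f x) (g l)} = q + 1" if "x \<in> {..<n}" for x
      using bij_betw_card_Collect[OF g, of "\<lambda>l. incident (f x) l"] lines_per_point fP that by simp
  qed (simp_all add: order_ge_2 n_def)
  then show ?thesis
    by (intro exI[of _ "{..<n}"] exI[of _ "{n..<2 * n}"]) auto
qed

text \<open>
  The line through \<open>p\<close> and \<open>x\<close> serves as the label of the group of \<open>x\<close>. A line that joins points
  of different groups cannot pass through \<open>p\<close>, hence survives, whereas the line that joins
  two points of the same group is their common line through \<open>p\<close>, which is deleted.
\<close>

lemma plane_minus_point_and_line:
  fixes P L :: "'v set"
  assumes "finite_projective_plane q P L inc" "P \<inter> L = {}" "p \<in> P" "l \<in> L"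
  shows "group_divisible_design (if inc p l then q^2 else q^2 - 1) q (if inc p l then q else q - 1)
    {x \<in> P. x \<noteq> p \<and> \<not> inc x l} {m \<in> L. m \<noteq> l \<and> \<not> inc p m} inc
    (finite_projective_plane.line_through L inc p)"
proof -
  interpret finite_projective_plane q P L inc by fact
  interpret D: finite_projective_plane q L P "\<lambda>l x. inc x l" by (rule dual)
  show ?thesis
  proof
    have "q < q * q" using order_ge_2 by simp
    then show "(if inc p l then q else q - 1) < (if inc p l then q^2 else q^2 - 1)"
      using order_ge_2 unfolding power2_eq_square by (simp, linarith)
    show "\<exists>m\<in>{m \<in> L. m \<noteq> l \<and> \<not> inc p m}. inc x m \<and> inc y m"
      if "x \<in> {x \<in> P. x \<noteq> p \<and> \<not> inc x l}" "y \<in> {x \<in> P. x \<noteq> p \<and> \<not> inc x l}"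
        "line_through p x \<noteq> line_through p y" for x y
    proof -
      from that have xy: "x \<in> P" "y \<in> P" "x \<noteq> y" by auto
      have "\<not> inc p (line_through x y)"
        using that line_through[OF xy] assms
          line_through_eqI[of p x "line_through x y"] line_through_eqI[of p y "line_through x y"] by auto
      with line_through[OF xy] that show ?thesis
        by (intro bexI[of _ "line_through x y"]) auto
    qed
    show "x = y"
      if "x \<in> {x \<in> P. x \<noteq> p \<and> \<not> inc x l}" "y \<in> {x \<in> P. x \<noteq> p \<and> \<not> inc x l}"
        "m \<in> {m \<in> L. m \<noteq> l \<and> \<not> inc p m}" "inc x m" "inc y m"
        "line_through p x = line_through p y" for x y m
    proof (rule ccontr)
      assume "x \<noteq> y"
      with that assms line_through[of p x] line_through[of p y] have "line_through p x = m"
        using line_through_eqI[of x y m] line_through_eqI[of x y "line_through p x"] by auto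
      with that assms line_through[of p x] show False by auto
    qed
    show "m = m'"
      if "x \<in> {x \<in> P. x \<noteq> p \<and> \<not> inc x l}" "y \<in> {x \<in> P. x \<noteq> p \<and> \<not> inc x l}" "x \<noteq> y"
        "m \<in> {m \<in> L. m \<noteq> l \<and> \<not> inc p m}" "m' \<in> {m \<in> L. m \<noteq> l \<and> \<not> inc p m}"
        "inc x m" "inc y m" "inc x m'" "inc y m'" for x y m m'
      using that line_through_eqI[of x y m] line_through_eqI[of x y m'] by auto
    show "card {x \<in> {x \<in> P. x \<noteq> p \<and> \<not> inc x l}. inc x m} = q"
      if "m \<in> {m \<in> L. m \<noteq> l \<and> \<not> inc p m}" for m
      using D.card_lines_avoiding[OF assms(4,3), of m] that by simp
    show "finite {x \<in> P. x \<noteq> p \<and> \<not> inc x l}" "finite {m \<in> L. m \<noteq> l \<and> \<not> inc p m}"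
      using finite_points D.finite_points by simp_all
    show "{x \<in> P. x \<noteq> p \<and> \<not> inc x l} \<inter> {m \<in> L. m \<noteq> l \<and> \<not> inc p m} = {}"
      using assms(2) by blast
    show "card {x \<in> P. x \<noteq> p \<and> \<not> inc x l} = (if inc p l then q^2 else q^2 - 1)"
      by (rule card_points_off[OF assms(3,4)])
    show "card {m \<in> L. m \<noteq> l \<and> \<not> inc p m} = (if inc p l then q^2 else q^2 - 1)"
      by (rule D.card_points_off[OF assms(4,3)])
    show "card {m \<in> {m \<in> L. m \<noteq> l \<and> \<not> inc p m}. inc x m} = q"
      if "x \<in> {x \<in> P. x \<noteq> p \<and> \<not> inc x l}" for x
      using card_lines_avoiding[OF assms(3,4), of x] that by simp
    show "card {y \<in> {x \<in> P. x \<noteq> p \<and> \<not> inc x l}. line_through p y = line_through p x} =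
        (if inc p l then q else q - 1)" if "x \<in> {x \<in> P. x \<noteq> p \<and> \<not> inc x l}" for x
      using card_points_on_line_through[OF assms(3,4), of x] that by simp
  qed
qed

section \<open>The construction\<close>

theorem theorem5p5:
  fixes r k w :: nat
    and P :: "'p set" and L :: "'l set" and incident :: "'p \<Rightarrow> 'l \<Rightarrow> bool"
    and \<Gamma> :: "'a pair_pre_digraph"
  assumes "r \<ge> 2" and "k \<ge> 1"
    and "finite_projective_plane r P L incident"
    and "pair_graph \<Gamma>" and "regular k \<Gamma>" and "girth \<Gamma> \<ge> 5"
    and "card (pverts \<Gamma>) = w" and "w = r - 1 \<or> w = r"
  shows "\<exists>(G :: nat pair_pre_digraph) v.
    (w = r - 1 \<longrightarrow> v = 2 * r^2 - 2) \<and> (w = r \<longrightarrow> v = 2 * r^2) \<and>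
    babi_graph r (r + k) 5 G \<and> card (pverts G) = v \<and>
    real (card (fat_edges (r + k) G)) = real v / 4 * real k \<and>
    thin_edges r G = {}"
proof -
  obtain P' L' :: "nat set" and inc where plane: "finite_projective_plane r P' L' inc"
    and disj: "P' \<inter> L' = {}"
    using finite_projective_plane.relabel[OF assms(3)] by auto
  interpret finite_projective_plane r P' L' inc by (rule plane)
  obtain p l where pl: "p \<in> P'" "l \<in> L'" "inc p l \<longleftrightarrow> w = r"
    using ex_flag ex_antiflag by metis
  define n where "n = (if inc p l then r^2 else r^2 - 1)"
  define Q where "Q = {x \<in> P'. x \<noteq> p \<and> \<not> inc x l}"
  define M where "M = {m \<in> L'. m \<noteq> l \<and> \<not> inc p m}"
  have "(if inc p l then r else r - 1) = w"
    using pl(3) assms(1,8) by auto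
  with plane_minus_point_and_line[OF plane disj pl(1,2)]
  interpret group_divisible_design n r w Q M inc "line_through p"
    by (simp add: n_def Q_def M_def)
  interpret pair_graph \<Gamma> by fact
  obtain lab where lab: "\<forall>x\<in>Q. bij_betw lab {y \<in> Q. line_through p y = line_through p x} (pverts \<Gamma>)"
    using ex_group_labelling[OF pair_finite_verts assms(7)] by auto
  interpret A: amalgam n r w Q M inc "line_through p" \<Gamma> k lab
    using assms lab by unfold_locales auto
  have "real (card (fat_edges (r + k) A.graph)) = real (2 * n) / 4 * real k"
    using arg_cong[OF A.card_fat_edges_graph, of real] by simp
  moreover have "2 * n = 2 * r^2 - 2" if "w = r - 1"
    using that pl(3) assms(1) by (auto simp: n_def)
  moreover have "2 * n = 2 * r^2" if "w = r"
    using that pl(3) by (simp add: n_def)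
  ultimately show ?thesis
    using A.babi_graph_graph A.card_pverts_graph A.thin_edges_graph by blast
qed

end
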